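(* Let $\xi$ be a probabilistic guard, $C'$ a program, and $[(f,g)]_{\approx}\in\mathbb{IE}$. Then the limit $$\widetilde{\mathsf{wp}}[\mathtt{while}(\xi)\{C'\}]\,[(f,g)]_{\approx}=\lim_{n\to\omega}\Psi^{n}\big([(\mathbf 0,\mathbf 0)]_{\approx}\big),\qquad \Psi([(X,Y)]_{\approx})=(1-p_\xi)\cdot[(f,g)]_{\approx}+p_\xi\cdot\widetilde{\mathsf{wp}}[C']\,[(X,Y)]_{\approx},$$ exists, and hence the $\widetilde{\mathsf{wp}}$--semantics of any while-loop with respect to any post-expectation is well-defined.
   Context: Programs are built by $C::=\mathtt{skip}\mid x:=E\mid C;C\mid \mathtt{if}(\xi)\{C\}\mathtt{else}\{C\}\mid\mathtt{while}(\xi)\{C\}$ over a set $\Sigma$ of program states, where a probabilistic guard $\xi$ is interpreted as $p_\xi:\Sigma\to[0,1]$, the probability that $\xi$ evaluates to true. $\mathbb{E}^{\star}$ is the set of functions $\Sigma\to\mathbb R$, $\mathbb{E}_{\geq 0}^{\infty}$ the set of functions $\Sigma\to[0,\infty]$, $\mathbf 0=\lambda\sigma.0$. $\mathbb P=\{(f,g)\mid f\in\mathbb{E}^{\star},g\in\mathbb{E}_{\geq0}^{\infty},|f|\le g\}$; $(f,g)\approx(f',g')$ iff for all $\sigma$, ($g(\sigma)\ne\infty$ or $g'(\sigma)\ne\infty$) implies $f(\sigma)=f'(\sigma)$ and $g(\sigma)=g'(\sigma)$; $[(f,g)]_{\approx}$ denotes the equivalence class and $\mathbb{IE}$ the set of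 classes. Operations: $(f,g)+(f',g')=(f+f',g+g')$, $c\cdot(f,g)=(cf,|c|g)$ for $c\in\mathbb R$, $h\cdot(f,g)=(hf,|h|g)$ for $h\in\mathbb E^\star$, lifted to classes. The transformer $\widetilde{\mathsf{wp}}[C]:\mathbb{IE}\to\mathbb{IE}$ is: skip is identity; $x:=E$ maps $[(f,g)]_\approx$ to $[(f[x/E],g[x/E])]_\approx$; $C_1;C_2$ gives $\widetilde{\mathsf{wp}}[C_1](\widetilde{\mathsf{wp}}[C_2][(f,g)]_\approx)$; if-then-else gives $p_\xi\cdot\widetilde{\mathsf{wp}}[C_1][(f,g)]_\approx+(1-p_\xi)\cdot\widetilde{\mathsf{wp}}[C_2][(f,g)]_\approx$; while as in the claim. A class $[(f,g)]_\approx$ is a limit of $([(f_n,g_n)]_\approx)_n$ if there are representatives $(f_n',g_n')$ with $g(\sigma)=\lim g_n'(\sigma)$ ($\infty$ allowed) and $f(\sigma)=\lim f_n'(\sigma)$ when $\lim g_n'(\sigma)\ne\infty$, $f(\sigma)=0$ otherwise. *)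

theory Defs
  imports Complex_Main "HOL-Library.Extended_Nonnegative_Real"
begin

section \<open>Programs\<close>

type_synonym ('v, 'a) state = "'v \<Rightarrow> 'a"

text \<open>A guard is identified with the function giving the probability that it evaluates to true,
  and an expression with its evaluation function on states.\<close>

typedef 's guard = "{p :: 's \<Rightarrow> real. \<forall>\<sigma>. 0 \<le> p \<sigma> \<and> p \<sigma> \<le> 1}"
  morphisms prob Guard
  by (rule exI[of _ "\<lambda>_. 0"]) simp

datatype ('v, 'a) prog =
    Skip
  | Assign 'v "('v, 'a) state \<Rightarrow> 'a"
  | Seq "('v, 'a) prog" "('v, 'a) prog"
  | Cond "('v, 'a) state guard" "('v, 'a) prog" "('v, 'a) prog"
  | While "('v, 'a) state guard" "('v, 'a) prog"


section \<open>Integrability-witnessing pairs\<close>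

typedef 's ipair = "{(f :: 's \<Rightarrow> real, g :: 's \<Rightarrow> ennreal). \<forall>\<sigma>. ennreal \<bar>f \<sigma>\<bar> \<le> g \<sigma>}"
  by (rule exI[of _ "(\<lambda>_. 0, \<lambda>_. 0)"]) simp

setup_lifting type_definition_ipair

lift_definition expect :: "'s ipair \<Rightarrow> 's \<Rightarrow> real" is fst .

lift_definition witness :: "'s ipair \<Rightarrow> 's \<Rightarrow> ennreal" is snd .

instantiation ipair :: (type) "{zero, plus}"
begin

lift_definition zero_ipair :: "'a ipair" is "(\<lambda>_. 0, \<lambda>_. 0)"
  by simp

lift_definition plus_ipair :: "'a ipair \<Rightarrow> 'a ipair \<Rightarrow> 'a ipair" is
  "\<lambda>(f, g) (f', g'). (\<lambda>\<sigma>. f \<sigma> + f' \<sigma>, \<lambda>\<sigma>. g \<sigma> + g' \<sigma>)"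
proof clarsimp
  fix f f' :: "'a \<Rightarrow> real" and g g' :: "'a \<Rightarrow> ennreal" and \<sigma>
  assume "\<forall>\<sigma>. ennreal \<bar>f \<sigma>\<bar> \<le> g \<sigma>" "\<forall>\<sigma>. ennreal \<bar>f' \<sigma>\<bar> \<le> g' \<sigma>"
  then have "ennreal \<bar>f \<sigma>\<bar> + ennreal \<bar>f' \<sigma>\<bar> \<le> g \<sigma> + g' \<sigma>"
    by (simp add: add_mono)
  moreover have "ennreal \<bar>f \<sigma> + f' \<sigma>\<bar> \<le> ennreal \<bar>f \<sigma>\<bar> + ennreal \<bar>f' \<sigma>\<bar>"
    by (simp flip: ennreal_plus add: ennreal_leI)
  ultimately show "ennreal \<bar>f \<sigma> + f' \<sigma>\<bar> \<le> g \<sigma> + g' \<sigma>"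
    by (rule order_trans[rotated])
qed

instance ..

end

text \<open>The multiplication of type \<^typ>\<open>ennreal\<close> satisfies \<open>0 * \<infinity> = 0\<close>.\<close>

lift_definition ipair_scale :: "('s \<Rightarrow> real) \<Rightarrow> 's ipair \<Rightarrow> 's ipair" is
  "\<lambda>h (f, g). (\<lambda>\<sigma>. h \<sigma> * f \<sigma>, \<lambda>\<sigma>. ennreal \<bar>h \<sigma>\<bar> * g \<sigma>)"
  by (auto simp: abs_mult ennreal_mult intro!: mult_left_mono)

lift_definition ipair_subst ::
  "'v \<Rightarrow> (('v, 'a) state \<Rightarrow> 'a) \<Rightarrow> ('v, 'a) state ipair \<Rightarrow> ('v, 'a) state ipair" is
  "\<lambda>x E (f, g). (\<lambda>\<sigma>. f (\<sigma>(x := E \<sigma>)), \<lambda>\<sigma>. g (\<sigma>(x := E \<sigma>)))"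
  by auto

definition ipair_eq :: "'s ipair \<Rightarrow> 's ipair \<Rightarrow> bool" (infix "\<approx>" 50) where
  "P \<approx> Q \<longleftrightarrow> (\<forall>\<sigma>. witness P \<sigma> \<noteq> \<infinity> \<or> witness Q \<sigma> \<noteq> \<infinity> \<longrightarrow>
     expect P \<sigma> = expect Q \<sigma> \<and> witness P \<sigma> = witness Q \<sigma>)"

lemma expect_simps [simp]:
  "expect 0 \<sigma> = 0"
  "expect (P + Q) \<sigma> = expect P \<sigma> + expect Q \<sigma>"
  "expect (ipair_scale h P) \<sigma> = h \<sigma> * expect P \<sigma>"
  by (transfer; auto)+

lemma witness_simps [simp]:
  "witness 0 \<sigma> = 0"
  "witness (P + Q) \<sigma> = witness P \<sigma> + witness Q \<sigma>"
  "witness (ipair_scale h P) \<sigma> = ennreal \<bar>h \<sigma>\<bar> * witness P \<sigma>"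
  by (transfer; auto)+

lemma ipair_subst_simps [simp]:
  "expect (ipair_subst x E P) \<sigma> = expect P (\<sigma>(x := E \<sigma>))"
  "witness (ipair_subst x E P) \<sigma> = witness P (\<sigma>(x := E \<sigma>))"
  by (transfer; auto)+

lemma equivp_ipair_eq: "equivp (\<approx>)"
proof (rule equivpI)
  show "reflp (\<approx>)"
    by (simp add: reflp_def ipair_eq_def)
  show "symp (\<approx>)"
    unfolding symp_def ipair_eq_def by metis
  show "transp (\<approx>)"
    unfolding transp_def ipair_eq_def by metis
qed


section \<open>Integrability-witnessing expectations\<close>

quotient_type 's iexp = "'s ipair" / "(\<approx>)"
  morphisms rep_iexp iclass
  by (rule equivp_ipair_eq)

instantiation iexp :: (type) "{zero, plus}"
begin

lift_definition zero_iexp :: "'a iexp" is 0 .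

lift_definition plus_iexp :: "'a iexp \<Rightarrow> 'a iexp \<Rightarrow> 'a iexp" is "(+)"
  unfolding ipair_eq_def by (auto simp: ennreal_add_eq_top)

instance ..

end

lift_definition iexp_scale :: "('s \<Rightarrow> real) \<Rightarrow> 's iexp \<Rightarrow> 's iexp" (infixr "\<cdot>\<^sub>E" 70) is ipair_scale
  unfolding ipair_eq_def by (auto simp: ennreal_mult_eq_top_iff)

lift_definition iexp_subst ::
  "'v \<Rightarrow> (('v, 'a) state \<Rightarrow> 'a) \<Rightarrow> ('v, 'a) state iexp \<Rightarrow> ('v, 'a) state iexp" is ipair_subst
  unfolding ipair_eq_def by simp

definition is_ilimit :: "(nat \<Rightarrow> 's iexp) \<Rightarrow> 's iexp \<Rightarrow> bool" where
  "is_ilimit S L \<longleftrightarrow> (\<exists>P Q. iclass P = L \<and> (\<forall>n. iclass (Q n) = S n) \<and>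
     (\<forall>\<sigma>. (\<lambda>n. witness (Q n) \<sigma>) \<longlonglongrightarrow> witness P \<sigma> \<and>
          (if witness P \<sigma> \<noteq> \<infinity> then (\<lambda>n. expect (Q n) \<sigma>) \<longlonglongrightarrow> expect P \<sigma>
           else expect P \<sigma> = 0)))"

definition ilim :: "(nat \<Rightarrow> 's iexp) \<Rightarrow> 's iexp" where
  "ilim S = (THE L. is_ilimit S L)"


section \<open>The transformer\<close>

definition loop_fun :: "'s guard \<Rightarrow> ('s iexp \<Rightarrow> 's iexp) \<Rightarrow> 's iexp \<Rightarrow> 's iexp \<Rightarrow> 's iexp" where
  "loop_fun \<xi> T F X = (\<lambda>\<sigma>. 1 - prob \<xi> \<sigma>) \<cdot>\<^sub>E F + prob \<xi> \<cdot>\<^sub>E T X"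

text \<open>In the loop clause, \<^const>\<open>ilim\<close> is unspecified unless there is exactly one limit.\<close>

primrec wp :: "('v, 'a) prog \<Rightarrow> ('v, 'a) state iexp \<Rightarrow> ('v, 'a) state iexp" where
  "wp Skip = (\<lambda>F. F)"
| "wp (Assign x E) = (\<lambda>F. iexp_subst x E F)"
| "wp (Seq C1 C2) = (\<lambda>F. wp C1 (wp C2 F))"
| "wp (Cond \<xi> C1 C2) = (\<lambda>F. prob \<xi> \<cdot>\<^sub>E wp C1 F + (\<lambda>\<sigma>. 1 - prob \<xi> \<sigma>) \<cdot>\<^sub>E wp C2 F)"
| "wp (While \<xi> C) = (\<lambda>F. ilim (\<lambda>n. (loop_fun \<xi> (wp C) F ^^ n) 0))"

end

theory Submission
  imports Defs
begin

text \<open>Order integrability-witnessing pairs by \<open>(f, g) \<le> (f', g')\<close> iff \<open>g + \<bar>f' - f\<bar> \<le> g'\<close>: the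
  increase of the witness pays for the change of the expectation. This is compatible with
  \<open>\<approx>\<close>, has \<open>0\<close> as least element, and becomes antisymmetric on classes. Along an increasing
  sequence the witnesses converge in \<open>[0, \<infinity>]\<close>, and wherever their limit is finite the
  expectations form a Cauchy sequence, so every increasing sequence has a limit. Limits are monotone
  in the sequence, hence unique by antisymmetry. By induction on the program, \<open>wp\<close> is monotone;
  therefore the loop iterates increase from \<open>0\<close>, which gives the limit.\<close>

section \<open>The order on pairs\<close>

lemma expect_le_witness: "ennreal \<bar>expect P \<sigma>\<bar> \<le> witness P \<sigma>"
  by transfer auto

instantiation ipair :: (type) preorder
begin

text \<open>The additive form avoids subtracting witnesses, which may be infinite; at states where
  \<open>witness Q\<close> is infinite the condition holds trivially.\<close>

definition less_eq_ipair :: "'a ipair \<Rightarrow> 'a ipair \<Rightarrow> bool" where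
  "P \<le> Q \<longleftrightarrow> (\<forall>\<sigma>. witness P \<sigma> + ennreal \<bar>expect Q \<sigma> - expect P \<sigma>\<bar> \<le> witness Q \<sigma>)"

definition less_ipair :: "'a ipair \<Rightarrow> 'a ipair \<Rightarrow> bool" where
  "less_ipair P Q \<longleftrightarrow> P \<le> Q \<and> \<not> Q \<le> P"

instance
proof
  fix P Q R :: "'a ipair"
  show "P < Q \<longleftrightarrow> P \<le> Q \<and> \<not> Q \<le> P"
    by (rule less_ipair_def)
  show "P \<le> P"
    by (simp add: less_eq_ipair_def)
  assume PQ: "P \<le> Q" and QR: "Q \<le> R"
  show "P \<le> R"
    unfolding less_eq_ipair_def
  proof
    fix \<sigma>
    \<comment> \<open>The two costs add up by the triangle inequality for the expectations.\<close>
    have "ennreal \<bar>expect R \<sigma> - expect P \<sigma>\<bar>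
        \<le> ennreal \<bar>expect Q \<sigma> - expect P \<sigma>\<bar> + ennreal \<bar>expect R \<sigma> - expect Q \<sigma>\<bar>"
      by (simp flip: ennreal_plus add: ennreal_leI)
    then have "witness P \<sigma> + ennreal \<bar>expect R \<sigma> - expect P \<sigma>\<bar>
        \<le> (witness P \<sigma> + ennreal \<bar>expect Q \<sigma> - expect P \<sigma>\<bar>) + ennreal \<bar>expect R \<sigma> - expect Q \<sigma>\<bar>"
      by (simp add: add.assoc add_left_mono)
    also have "\<dots> \<le> witness Q \<sigma> + ennreal \<bar>expect R \<sigma> - expect Q \<sigma>\<bar>"
      using PQ by (simp add: less_eq_ipair_def add_right_mono)
    also have "\<dots> \<le> witness R \<sigma>"
      using QR by (simp add: less_eq_ipair_def)
    finally show "witness P \<sigma> + ennreal \<bar>expect R \<sigma> - expect P \<sigma>\<bar> \<le> witness R \<sigma>" .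
  qed
qed

end

lemma witness_mono: "P \<le> Q \<Longrightarrow> witness P \<sigma> \<le> witness Q \<sigma>"
  by (metis add_increasing2 dual_order.trans less_eq_ipair_def order_refl zero_le)

text \<open>This is the defining constraint |f| \<le> g of a pair: starting from 0, the witness pays
  for the whole expectation.\<close>

lemma ipair_zero_le: "0 \<le> (P :: 's ipair)"
  by (simp add: less_eq_ipair_def expect_le_witness)

text \<open>Where a witness is finite, the pairs agree and the cost is 0; elsewhere the right-hand
  witness is infinite. By symmetry and transitivity this makes the order respect \<approx>.\<close>

lemma ipair_eq_imp_le: "P \<approx> Q \<Longrightarrow> P \<le> Q"
  unfolding less_eq_ipair_def ipair_eq_def
  by (metis abs_zero add.right_neutral diff_self ennreal_0 infinity_ennreal_def order_refl top_greatest)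

lemma ipair_le_antisym:
  assumes "P \<le> Q" and "Q \<le> P"
  shows "P \<approx> Q"
  unfolding ipair_eq_def
proof (intro allI impI)
  fix \<sigma>
  assume fin: "witness P \<sigma> \<noteq> \<infinity> \<or> witness Q \<sigma> \<noteq> \<infinity>"
  have eq: "witness P \<sigma> = witness Q \<sigma>"
    using assms by (simp add: antisym witness_mono)
  moreover have "witness P \<sigma> + ennreal \<bar>expect Q \<sigma> - expect P \<sigma>\<bar> \<le> witness P \<sigma> + 0"
    using assms(1) unfolding less_eq_ipair_def eq[symmetric] by (metis add.right_neutral eq)
  \<comment> \<open>A finite witness can be cancelled, which leaves nothing to pay for a change of
    the expectation.\<close>
  then have "ennreal \<bar>expect Q \<sigma> - expect P \<sigma>\<bar> \<le> 0"
    using fin eq by (subst (asm) ennreal_add_left_cancel_le) auto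
  then have "expect P \<sigma> = expect Q \<sigma>"
    by (simp add: ennreal_eq_0_iff)
  ultimately show "expect P \<sigma> = expect Q \<sigma> \<and> witness P \<sigma> = witness Q \<sigma>"
    by simp
qed

lemma ipair_add_mono:
  fixes P :: "'s ipair"
  assumes "P \<le> P'" and "Q \<le> Q'"
  shows "P + Q \<le> P' + Q'"
  unfolding less_eq_ipair_def
proof
  fix \<sigma>
  have "ennreal \<bar>expect (P' + Q') \<sigma> - expect (P + Q) \<sigma>\<bar>
      \<le> ennreal \<bar>expect P' \<sigma> - expect P \<sigma>\<bar> + ennreal \<bar>expect Q' \<sigma> - expect Q \<sigma>\<bar>"
    by (simp flip: ennreal_plus add: ennreal_leI)
  then have "witness (P + Q) \<sigma> + ennreal \<bar>expect (P' + Q') \<sigma> - expect (P + Q) \<sigma>\<bar>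
      \<le> witness (P + Q) \<sigma> +
        (ennreal \<bar>expect P' \<sigma> - expect P \<sigma>\<bar> + ennreal \<bar>expect Q' \<sigma> - expect Q \<sigma>\<bar>)"
    by (rule add_left_mono)
  also have "\<dots> = (witness P \<sigma> + ennreal \<bar>expect P' \<sigma> - expect P \<sigma>\<bar>) +
      (witness Q \<sigma> + ennreal \<bar>expect Q' \<sigma> - expect Q \<sigma>\<bar>)"
    by (simp add: ac_simps)
  also have "\<dots> \<le> witness (P' + Q') \<sigma>"
    using assms unfolding less_eq_ipair_def by (simp add: add_mono)
  finally show "witness (P + Q) \<sigma> + ennreal \<bar>expect (P' + Q') \<sigma> - expect (P + Q) \<sigma>\<bar>
      \<le> witness (P' + Q') \<sigma>" .
qed

text \<open>Negative \<open>h\<close> is allowed, since the witness and the change of the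
  expectation are both scaled by |h|.\<close>

lemma ipair_scale_mono:
  assumes "P \<le> Q"
  shows "ipair_scale h P \<le> ipair_scale h Q"
  unfolding less_eq_ipair_def
proof
  fix \<sigma>
  have "ennreal \<bar>h \<sigma> * expect Q \<sigma> - h \<sigma> * expect P \<sigma>\<bar>
      = ennreal \<bar>h \<sigma>\<bar> * ennreal \<bar>expect Q \<sigma> - expect P \<sigma>\<bar>"
    by (simp flip: ennreal_mult abs_mult add: right_diff_distrib)
  then show "witness (ipair_scale h P) \<sigma> + ennreal \<bar>expect (ipair_scale h Q) \<sigma> - expect (ipair_scale h P) \<sigma>\<bar>
      \<le> witness (ipair_scale h Q) \<sigma>"
    using assms by (simp add: less_eq_ipair_def mult_left_mono flip: distrib_left)
qed

lemma ipair_subst_mono: "P \<le> Q \<Longrightarrow> ipair_subst x E P \<le> ipair_subst x E Q"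
  by (simp add: less_eq_ipair_def)

section \<open>The induced order on classes\<close>

instantiation iexp :: (type) order
begin

lift_definition less_eq_iexp :: "'a iexp \<Rightarrow> 'a iexp \<Rightarrow> bool" is "(\<le>)"
  by (meson equivp_ipair_eq equivp_symp ipair_eq_imp_le order_trans)

definition less_iexp :: "'a iexp \<Rightarrow> 'a iexp \<Rightarrow> bool" where
  "less_iexp X Y \<longleftrightarrow> X \<le> Y \<and> \<not> Y \<le> X"

instance
proof
  fix X Y Z :: "'a iexp"
  show "X < Y \<longleftrightarrow> X \<le> Y \<and> \<not> Y \<le> X"
    by (rule less_iexp_def)
  show "X \<le> X"
    by transfer simp
  show "X \<le> Y \<Longrightarrow> Y \<le> Z \<Longrightarrow> X \<le> Z"
    by transfer (rule order_trans)
  show "X \<le> Y \<Longrightarrow> Y \<le> X \<Longrightarrow> X = Y"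
    by transfer (rule ipair_le_antisym)
qed

end

lemma iexp_zero_le: "0 \<le> (X :: 's iexp)"
  by transfer (rule ipair_zero_le)

lemma iexp_add_mono: "X \<le> X' \<Longrightarrow> Y \<le> Y' \<Longrightarrow> X + Y \<le> X' + (Y' :: 's iexp)"
  by transfer (rule ipair_add_mono)

lemma iexp_scale_mono: "X \<le> Y \<Longrightarrow> h \<cdot>\<^sub>E X \<le> h \<cdot>\<^sub>E Y"
  by transfer (rule ipair_scale_mono)

lemma iexp_subst_mono: "X \<le> Y \<Longrightarrow> iexp_subst x E X \<le> iexp_subst x E Y"
  by transfer (rule ipair_subst_mono)

text \<open>With \<open>F = F'\<close> this makes the loop iterates increase; with varying
  \<open>F\<close> it compares the iterates of two post-expectations.\<close>

lemma loop_fun_mono: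
  assumes "mono T" and "F \<le> F'" and "X \<le> X'"
  shows "loop_fun \<xi> T F X \<le> loop_fun \<xi> T F' X'"
  unfolding loop_fun_def using assms by (intro iexp_add_mono iexp_scale_mono) (auto dest: monoD)

section \<open>Limits of sequences of classes\<close>

lemma is_ilimit_mono:
  assumes "is_ilimit S L" and "is_ilimit S' L'" and le: "\<And>n. S n \<le> S' n"
  shows "L \<le> L'"
proof -
  obtain P Q where P: "iclass P = L" and Q: "\<And>n. iclass (Q n) = S n"
    and w: "\<And>\<sigma>. (\<lambda>n. witness (Q n) \<sigma>) \<longlonglongrightarrow> witness P \<sigma>"
    and e: "\<And>\<sigma>. witness P \<sigma> \<noteq> \<infinity> \<Longrightarrow> (\<lambda>n. expect (Q n) \<sigma>) \<longlonglongrightarrow> expect P \<sigma>"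
    using assms(1) unfolding is_ilimit_def by metis
  obtain P' Q' where P': "iclass P' = L'" and Q': "\<And>n. iclass (Q' n) = S' n"
    and w': "\<And>\<sigma>. (\<lambda>n. witness (Q' n) \<sigma>) \<longlonglongrightarrow> witness P' \<sigma>"
    and e': "\<And>\<sigma>. witness P' \<sigma> \<noteq> \<infinity> \<Longrightarrow> (\<lambda>n. expect (Q' n) \<sigma>) \<longlonglongrightarrow> expect P' \<sigma>"
    using assms(2) unfolding is_ilimit_def by metis
  \<comment> \<open>The representatives of the two sequences are chosen independently; they are
    comparable because the order respects \<approx>.\<close>
  have QQ': "Q n \<le> Q' n" for n
    using le[of n] by (simp flip: Q Q' add: less_eq_iexp.abs_eq)
  have "P \<le> P'"
    unfolding less_eq_ipair_def
  proof
    fix \<sigma>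
    show "witness P \<sigma> + ennreal \<bar>expect P' \<sigma> - expect P \<sigma>\<bar> \<le> witness P' \<sigma>"
    proof (cases "witness P' \<sigma> = \<infinity>")
      case False
      have "witness P \<sigma> \<le> witness P' \<sigma>"
        using w w' by (rule LIMSEQ_le) (auto intro: witness_mono QQ')
      \<comment> \<open>Finiteness is what makes \<open>e\<close> applicable, so that the inequality
        between \<open>Q n\<close> and \<open>Q' n\<close> can pass to the limit.\<close>
      with False have fin: "witness P \<sigma> \<noteq> \<infinity>"
        by (auto simp: top_unique)
      have "(\<lambda>n. witness (Q n) \<sigma> + ennreal \<bar>expect (Q' n) \<sigma> - expect (Q n) \<sigma>\<bar>)
          \<longlonglongrightarrow> witness P \<sigma> + ennreal \<bar>expect P' \<sigma> - expect P \<sigma>\<bar>"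
        by (intro tendsto_add tendsto_ennrealI tendsto_rabs tendsto_diff w e e' fin False)
      then show ?thesis
        using w' by (rule LIMSEQ_le) (use QQ' in \<open>auto simp: less_eq_ipair_def\<close>)
    qed simp
  qed
  then show ?thesis
    by (simp flip: P P' add: less_eq_iexp.abs_eq)
qed

lemma is_ilimit_unique: "is_ilimit S L \<Longrightarrow> is_ilimit S L' \<Longrightarrow> L = L'"
  by (simp add: antisym is_ilimit_mono)

lemma is_ilimit_ilim: "is_ilimit S L \<Longrightarrow> is_ilimit S (ilim S)"
  unfolding ilim_def by (rule theI) (auto intro: is_ilimit_unique)

text \<open>The expectations vary no more than the witnesses, which converge to a finite value and
  hence form a real Cauchy sequence.\<close>

lemma increasing_expect_convergent:
  assumes inc: "\<And>m n :: nat. m \<le> n \<Longrightarrow> Q m \<le> Q n" and lim: "(\<lambda>n. witness (Q n) \<sigma>) \<longlonglongrightarrow> b" and "b \<noteq> \<infinity>"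
  shows "convergent (\<lambda>n. expect (Q n) \<sigma>)"
proof -
  \<comment> \<open>All witnesses lie below the finite \<open>b\<close>, so the passage to reals
    loses nothing and makes differences meaningful.\<close>
  define v where "v n = enn2real (witness (Q n) \<sigma>)" for n
  have "incseq (\<lambda>n. witness (Q n) \<sigma>)"
    by (auto simp: incseq_def intro: witness_mono inc)
  then have "witness (Q n) \<sigma> \<le> b" for n
    using lim by (rule incseq_le)
  with \<open>b \<noteq> \<infinity>\<close> have wit: "witness (Q n) \<sigma> = ennreal (v n)" for n
    unfolding v_def by (metis ennreal_enn2real infinity_ennreal_def top.not_eq_extremum top_unique)
  have v0: "0 \<le> v n" for n
    by (simp add: v_def)
  have dist: "\<bar>expect (Q n) \<sigma> - expect (Q m) \<sigma>\<bar> \<le> v n - v m" if "m \<le> n" for m n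
  proof -
    have "Q m \<le> Q n"
      using that by (rule inc)
    then have "ennreal (v m + \<bar>expect (Q n) \<sigma> - expect (Q m) \<sigma>\<bar>) \<le> ennreal (v n)"
      using v0 by (simp add: less_eq_ipair_def flip: wit)
    then show ?thesis
      using v0[of n] by simp
  qed
  have "v \<longlonglongrightarrow> enn2real b"
    unfolding v_def using lim \<open>b \<noteq> \<infinity>\<close> by (intro tendsto_enn2real) (auto simp: top.not_eq_extremum)
  then have "Cauchy v"
    by (rule LIMSEQ_imp_Cauchy)
  then have "Cauchy (\<lambda>n. expect (Q n) \<sigma>)"
    \<comment> \<open>This form of the Cauchy property compares only with an earlier index, as
      \<open>dist\<close> requires.\<close>
    unfolding Cauchy_altdef2 dist_real_def by (meson abs_ge_self dist order_le_less_trans order_trans)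
  then show ?thesis
    by (rule real_Cauchy_convergent)
qed

lemma incseq_has_ilimit:
  assumes "incseq S"
  shows "\<exists>L. is_ilimit S L"
proof -
  define Q where "Q n = rep_iexp (S n)" for n
  have Q: "iclass (Q n) = S n" for n
    unfolding Q_def by (rule Quotient3_abs_rep[OF Quotient3_iexp])
  have inc: "Q m \<le> Q n" if "m \<le> n" for m n
    using incseqD[OF assms that] by (simp flip: Q add: less_eq_iexp.abs_eq)
  define g where "g \<sigma> = (SUP n. witness (Q n) \<sigma>)" for \<sigma>
  \<comment> \<open>The value 0 is prescribed by \<open>is_ilimit\<close>; the expectations may
    diverge at such states.\<close>
  define f where "f \<sigma> = (if g \<sigma> = \<infinity> then 0 else lim (\<lambda>n. expect (Q n) \<sigma>))" for \<sigma>
  have g: "(\<lambda>n. witness (Q n) \<sigma>) \<longlonglongrightarrow> g \<sigma>" for \<sigma>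
    unfolding g_def by (intro LIMSEQ_SUP) (auto simp: incseq_def intro: witness_mono inc)
  have f: "(\<lambda>n. expect (Q n) \<sigma>) \<longlonglongrightarrow> f \<sigma>" if "g \<sigma> \<noteq> \<infinity>" for \<sigma>
    using increasing_expect_convergent[OF inc g that] that by (simp add: f_def convergent_LIMSEQ_iff)
  \<comment> \<open>This puts \<open>(f, g)\<close> into the carrier of the pair type, so that
    \<open>Abs_ipair\<close> below preserves both components.\<close>
  have bound: "ennreal \<bar>f \<sigma>\<bar> \<le> g \<sigma>" for \<sigma>
  proof (cases "g \<sigma> = \<infinity>")
    case False
    then have "(\<lambda>n. ennreal \<bar>expect (Q n) \<sigma>\<bar>) \<longlonglongrightarrow> ennreal \<bar>f \<sigma>\<bar>"
      by (intro tendsto_ennrealI tendsto_rabs f)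
    then show ?thesis
      using g by (rule LIMSEQ_le) (auto intro: expect_le_witness)
  qed simp
  define P where "P = Abs_ipair (f, g)"
  have "expect P = f" and "witness P = g"
    using bound by (simp_all add: P_def expect.rep_eq witness.rep_eq Abs_ipair_inverse)
  then have "is_ilimit S (iclass P)"
    unfolding is_ilimit_def using Q f g by (intro exI[of _ P] exI[of _ Q]) (auto simp: f_def)
  then show ?thesis ..
qed

section \<open>Loop limits and monotonicity of the transformer\<close>

lemma loop_is_ilimit:
  assumes "mono T"
  shows "is_ilimit (\<lambda>n. (loop_fun \<xi> T F ^^ n) 0) (ilim (\<lambda>n. (loop_fun \<xi> T F ^^ n) 0))"
proof -
  have "(loop_fun \<xi> T F ^^ n) 0 \<le> (loop_fun \<xi> T F ^^ Suc n) 0" for n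
    by (induction n) (auto intro: iexp_zero_le loop_fun_mono assms)
  then have "incseq (\<lambda>n. (loop_fun \<xi> T F ^^ n) 0)"
    by (rule incseq_SucI)
  then show ?thesis
    using incseq_has_ilimit is_ilimit_ilim by blast
qed

lemma mono_wp: "mono (wp C)"
proof (induction C)
  case (While \<xi> C)
  show ?case
  proof (rule monoI)
    fix F F' :: "('a, 'b) state iexp"
    assume "F \<le> F'"
    then have "(loop_fun \<xi> (wp C) F ^^ n) 0 \<le> (loop_fun \<xi> (wp C) F' ^^ n) 0" for n
      by (induction n) (auto intro: loop_fun_mono While)
    \<comment> \<open>Both limits exist by the induction hypothesis for the body; for this use,
      \<open>loop_is_ilimit\<close> is stated for an arbitrary monotone \<open>T\<close>.\<close>
    then show "wp (While \<xi> C) F \<le> wp (While \<xi> C) F'"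
      using loop_is_ilimit[OF While] by (auto intro: is_ilimit_mono)
  qed
qed (auto intro!: monoI iexp_add_mono iexp_scale_mono iexp_subst_mono dest: monoD)

theorem theorem3:
  fixes \<xi> :: "('v, 'a) state guard" and C' :: "('v, 'a) prog"
    and F :: "('v, 'a) state iexp"
    and \<Psi> :: "('v, 'a) state iexp \<Rightarrow> ('v, 'a) state iexp"
  assumes "\<And>X. \<Psi> X = (\<lambda>\<sigma>. 1 - prob \<xi> \<sigma>) \<cdot>\<^sub>E F + prob \<xi> \<cdot>\<^sub>E wp C' X"
  shows "(\<exists>!L. is_ilimit (\<lambda>n. (\<Psi> ^^ n) 0) L) \<and>
         is_ilimit (\<lambda>n. (\<Psi> ^^ n) 0) (wp (While \<xi> C') F)"
proof -
  have "\<Psi> = loop_fun \<xi> (wp C') F"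
    using assms by (simp add: fun_eq_iff loop_fun_def)
  then have "is_ilimit (\<lambda>n. (\<Psi> ^^ n) 0) (wp (While \<xi> C') F)"
    by (simp add: loop_is_ilimit mono_wp)
  then show ?thesis
    using is_ilimit_unique by blast
qed

end
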